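(* Let $n\geq 5$ and let $G\in\mathfrak{C}_{n,1}$, i.e. $G$ is a connected graph on $n$ vertices with exactly one cut vertex. Then $\varepsilon(G)\leq \varepsilon(U_{n,n-1}^l)$.
   Context: All graphs are finite, simple, connected and undirected. The eccentricity of a vertex $v$ of $G$ is $e_G(v)=\max\{d_G(v,u): u\in V(G)\}$, and the total eccentricity index is $\varepsilon(G)=\sum_{v\in V(G)}e_G(v)$. A vertex $w$ is a cut vertex of $G$ if $G-w$ is disconnected. $\mathfrak{C}_{n,s}$ is the set of all connected graphs on $n$ vertices with exactly $s$ cut vertices. For $3\leq g\leq n-1$, $U_{n,g}^l$ is the unicyclic graph on $n$ vertices obtained by joining one end vertex of the path $P_{n-g}$ on $n-g$ vertices to a vertex of the cycle $C_g$ by an edge (the superscript $l$ is part of the name, not a variable); in particular $U_{n,n-1}^l$ is the cycle $C_{n-1}$ with one pendant vertex attached. *)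

theory Defs
  imports "Graph_Theory.Graph_Theory"
begin

text \<open>
  Finite simple undirected graphs are rendered by the locale \<open>pair_graph\<close>: an undirected edge
  between \<open>u\<close> and \<open>v\<close> is the pair of arcs \<open>(u,v)\<close> and \<open>(v,u)\<close>.
\<close>

definition gdist :: "'a pair_pre_digraph \<Rightarrow> 'a \<Rightarrow> 'a \<Rightarrow> nat" where
  "gdist G u v = (LEAST k. \<exists>p. pre_digraph.awalk (with_proj G) u p v \<and> length p = k)"

text \<open>On reachable pairs this is the weighted distance of the library for unit weights.\<close>

lemma gdist_eq_unit_weight_distance:
  assumes "pair_wf_digraph G" and "u \<rightarrow>\<^sup>*\<^bsub>with_proj G\<^esub> v"
  shows "wf_digraph.\<mu> (with_proj G) (\<lambda>_. 1) u v = ereal (real (gdist G u v))"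
proof -
  interpret pair_wf_digraph G by fact
  have wf: "wf_digraph (with_proj G)" ..
  let ?P = "\<lambda>k. \<exists>p. pre_digraph.awalk (with_proj G) u p v \<and> length p = k"
  have cost: "awalk_cost (\<lambda>_. 1) p = real (length p)" for p :: "('a \<times> 'a) list"
    by (induct p) (auto simp: awalk_cost_Nil awalk_cost_Cons)
  have "\<exists>k. ?P k"
    using assms(2) wf_digraph.reachable_awalk[OF wf] by blast
  then have "?P (gdist G u v)"
    unfolding gdist_def by (rule LeastI_ex)
  then obtain p where p: "pre_digraph.awalk (with_proj G) u p v" "length p = gdist G u v"
    by blast
  have le: "gdist G u v \<le> length q" if "pre_digraph.awalk (with_proj G) u q v" for q
    unfolding gdist_def using that by (intro Least_le) blast
  show ?thesis
    unfolding wf_digraph.\<mu>_def[OF wf] cost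
  proof (rule antisym)
    show "(INF p\<in>{p. pre_digraph.awalk (with_proj G) u p v}. ereal (real (length p)))
        \<le> ereal (real (gdist G u v))"
      using p by (intro INF_lower2[of p]) auto
    show "ereal (real (gdist G u v))
        \<le> (INF p\<in>{p. pre_digraph.awalk (with_proj G) u p v}. ereal (real (length p)))"
      using le by (intro INF_greatest) auto
  qed
qed

definition eccentricity :: "'a pair_pre_digraph \<Rightarrow> 'a \<Rightarrow> nat" where
  "eccentricity G v = Max ((\<lambda>u. gdist G v u) ` pverts G)"

definition total_eccentricity :: "'a pair_pre_digraph \<Rightarrow> nat" where
  "total_eccentricity G = (\<Sum>v\<in>pverts G. eccentricity G v)"

text \<open>
  The library counts the null graph as not connected; the second conjunct keeps the vertex
  of the one-vertex graph from being a cut vertex.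
\<close>

definition cut_vertex :: "'a pair_pre_digraph \<Rightarrow> 'a \<Rightarrow> bool" where
  "cut_vertex G w \<longleftrightarrow> w \<in> pverts G \<and> pverts G \<noteq> {w} \<and>
     \<not> connected (pre_digraph.del_vert (with_proj G) w)"

definition graphs_with_cut_vertices :: "nat \<Rightarrow> nat \<Rightarrow> 'a pair_pre_digraph set" where
  "graphs_with_cut_vertices n s =
     {G. pair_graph G \<and> connected (with_proj G) \<and> card (pverts G) = n \<and>
         card {w. cut_vertex G w} = s}"

text \<open>
  For \<open>3 \<le> g\<close> and \<open>g \<le> n - 1\<close>, the vertices below \<open>g\<close> form the cycle, the vertices from \<open>g\<close>
  to \<open>n - 1\<close> form the path, and \<open>(0, g)\<close> is the joining edge.
\<close>

definition unicyclic_l :: "nat \<Rightarrow> nat \<Rightarrow> nat pair_pre_digraph" where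
  "unicyclic_l n g =
     (let E = {(i, Suc i mod g) | i. i < g} \<union> {(0, g)} \<union> {(i, Suc i) | i. g \<le> i \<and> Suc i < n}
      in \<lparr> pverts = {..<n}, parcs = E \<union> E\<inverse> \<rparr>)"

lemma pair_graph_unicyclic_l:
  assumes "3 \<le> g" and "g < n"
  shows "pair_graph (unicyclic_l n g)"
proof -
  let ?E = "{(i, Suc i mod g) | i. i < g} \<union> {(0, g)} \<union> {(i, Suc i) | i. g \<le> i \<and> Suc i < n}"
  have arcs: "parcs (unicyclic_l n g) = ?E \<union> ?E\<inverse>" and verts: "pverts (unicyclic_l n g) = {..<n}"
    by (simp_all add: unicyclic_l_def Let_def)
  have mod_less: "Suc i mod g < g" for i
    using assms by simp
  have mod_neq: "Suc i mod g \<noteq> i" if "i < g" for i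
    using assms that by (auto simp: mod_Suc)
  have sub: "?E \<subseteq> {..<n} \<times> {..<n}"
  proof
    fix x assume "x \<in> ?E"
    then consider i where "x = (i, Suc i mod g)" "i < g" | "x = (0, g)"
      | i where "x = (i, Suc i)" "Suc i < n"
      by blast
    then show "x \<in> {..<n} \<times> {..<n}"
      by cases (use assms less_trans[OF mod_less assms(2)] in simp_all)
  qed
  have noloop: "a \<noteq> b" if "(a, b) \<in> ?E" for a b
  proof -
    have "a < g \<and> b = Suc a mod g \<or> a = 0 \<and> b = g \<or> b = Suc a"
      using that by blast
    then show ?thesis
      using assms mod_neq[of a] by (elim disjE) simp_all
  qed
  show ?thesis
  proof
    show "finite (pverts (unicyclic_l n g))"
      by (simp add: verts)
    show "finite (parcs (unicyclic_l n g))"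
      unfolding arcs using sub by (meson finite_SigmaI finite_Un finite_converse finite_lessThan finite_subset)
    show "symmetric (with_proj (unicyclic_l n g))"
      unfolding symmetric_def with_proj_simps arcs by (rule sym_Un_converse)
  next
    fix e assume e: "e \<in> parcs (unicyclic_l n g)"
    obtain a b where ab: "e = (a, b)" by (cases e)
    have d: "(a, b) \<in> ?E \<or> (b, a) \<in> ?E" using e unfolding arcs ab by blast
    then have "a \<in> {..<n} \<and> b \<in> {..<n}" using sub by blast
    then show "fst e \<in> pverts (unicyclic_l n g)" and "snd e \<in> pverts (unicyclic_l n g)"
      by (simp_all add: verts ab)
    have "a \<noteq> b" using d noloop[of a b] noloop[of b a] by blast
    then show "fst e \<noteq> snd e" by (simp add: ab)
  qed
qed

end

theory Submission
  imports Defs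
begin

text \<open>
  Let \<open>w\<close> be the cut vertex and \<open>k = \<lfloor>(n - 1) / 2\<rfloor>\<close>. In the cycle \<open>C\<^bsub>n-1\<^esub>\<close> with a pendant vertex every
  vertex has eccentricity at least \<open>k\<close>; the pendant vertex and the one or two cycle vertices
  opposite to its neighbour have eccentricity at least \<open>k + 1\<close>. This gives
  \<open>n k + 2\<close> (\<open>n\<close> odd) or \<open>n k + 3\<close> (\<open>n\<close> even) as a lower bound for the right-hand side
  (\<open>total_eccentricity_unicyclic_ge\<close>), and it remains to show that the same number bounds
  \<open>\<epsilon>(G)\<close> from above (\<open>total_eccentricity_unique_cut_vertex\<close>).

  For the upper bound, a component of \<open>G - w\<close> together with \<open>w\<close> stays connected when any
  one vertex is removed, since \<open>w\<close> is the only cut vertex (\<open>nonseparable_component\<close>). In such a set,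
  counting vertices by their distance from a fixed vertex, every level strictly between the first and
  the last contains at least two vertices (\<open>card_level_ge_2\<close>): a single vertex on a level would
  separate the lower levels from the higher ones. In particular two vertices of a set of size \<open>c\<close>
  are at distance at most \<open>c / 2\<close>.

  Let \<open>A\<close> be the component of \<open>G - w\<close> containing a vertex farthest from \<open>w\<close>, at distance \<open>h\<close>, let
  \<open>B\<close> be the union of the other components, and \<open>l \<le> h\<close> the largest distance from \<open>w\<close> to a vertex of \<open>B\<close>.
  A vertex \<open>v\<close> of \<open>B\<close> has eccentricity at most \<open>d(v,w) + h\<close>; for \<open>v\<close> in \<open>A\<close> it is at most
  the larger of \<open>q = \<lfloor>(|A| + 1) / 2\<rfloor>\<close> and \<open>d(v,w) + l\<close>. If \<open>q \<ge> h + l\<close>,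
  all these are at most \<open>q \<le> k\<close>. Otherwise they are at most \<open>h + l\<close>, and the two vertices on each inner level
  fall short of \<open>h + l\<close> by at least a known amount (\<open>sum_levels_ge\<close>, \<open>double_sum_min\<close>). The sum of the resulting estimates is a polynomial in \<open>n\<close>, \<open>h\<close>, \<open>l\<close>
  and \<open>q\<close>, which \<open>total_bound_of_heights\<close> compares with \<open>n k\<close>.
\<close>

section \<open>Distances in connected graphs\<close>

lemma length_rev_path [simp]: "length (rev_path p) = length p"
  by (induction p) auto

lemma (in pair_wf_digraph) gdist_le_walk:
  assumes "awalk u p v"
  shows "gdist G u v \<le> length p"
  unfolding gdist_def using assms by (intro Least_le) blast

lemma (in pair_wf_digraph) obtain_shortest_walk:
  assumes "u \<rightarrow>\<^sup>*\<^bsub>with_proj G\<^esub> v"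
  obtains p where "awalk u p v" "length p = gdist G u v"
proof -
  have "\<exists>k p. awalk u p v \<and> length p = k"
    using assms reachable_awalk by blast
  then have "\<exists>p. awalk u p v \<and> length p = gdist G u v"
    unfolding gdist_def by (rule LeastI_ex)
  then show thesis using that by blast
qed

text \<open>
  A function that grows by at most one along each arc certifies a lower bound for distances. For the
  explicit graph in question this replaces the computation of shortest walks.
\<close>

lemma (in pair_wf_digraph) lipschitz_le_gdist:
  fixes f :: "'a \<Rightarrow> int"
  assumes "\<And>x y. (x, y) \<in> parcs G \<Longrightarrow> f y \<le> f x + 1"
    and "u \<rightarrow>\<^sup>*\<^bsub>with_proj G\<^esub> v"
  shows "f v - f u \<le> int (gdist G u v)"
proof -
  obtain p where p: "awalk u p v" "length p = gdist G u v"
    using obtain_shortest_walk[OF assms(2)] .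
  have "f v \<le> f u + int (length p)"
    using p(1)
  proof (induction p arbitrary: u)
    case Nil
    then show ?case by (simp add: awalk_Nil_iff)
  next
    case (Cons e p)
    then have "e \<in> parcs G" "u = fst e" "f v \<le> f (snd e) + int (length p)"
      by (auto simp: awalk_Cons_iff)
    with assms(1)[of "fst e" "snd e"] show ?case by simp
  qed
  with p(2) show ?thesis by simp
qed

locale connected_pair_graph = pair_graph +
  assumes connected: "connected (with_proj G)"
begin

abbreviation dist where "dist \<equiv> gdist G"

lemma reachable_verts:
  assumes "u \<in> pverts G" "v \<in> pverts G"
  shows "u \<rightarrow>\<^sup>*\<^bsub>with_proj G\<^esub> v"
  using symmetric_connected_imp_strongly_connected[OF sym_arcs connected] assms
  by (auto simp: strongly_connected_def)

lemma ex_shortest_walk: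
  assumes "u \<in> pverts G" "v \<in> pverts G"
  shows "\<exists>p. awalk u p v \<and> length p = dist u v"
  using obtain_shortest_walk[OF reachable_verts[OF assms]] by blast

lemma dist_self [simp]:
  assumes "u \<in> pverts G"
  shows "dist u u = 0"
  using gdist_le_walk[of u "[]" u] assms by (simp add: awalk_Nil_iff)

lemma dist_eq_0_iff:
  assumes "u \<in> pverts G" "v \<in> pverts G"
  shows "dist u v = 0 \<longleftrightarrow> u = v"
proof
  assume "dist u v = 0"
  then have "awalk u [] v"
    using ex_shortest_walk[OF assms] by auto
  then show "u = v" by (simp add: awalk_Nil_iff)
qed (use assms in simp)

lemma dist_triangle:
  assumes "u \<in> pverts G" "v \<in> pverts G" "x \<in> pverts G"
  shows "dist u v \<le> dist u x + dist x v"
proof -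
  obtain p q where "awalk u p x" "length p = dist u x" "awalk x q v" "length q = dist x v"
    using ex_shortest_walk[of u x] ex_shortest_walk[of x v] assms by blast
  then show ?thesis
    using gdist_le_walk[of u "p @ q" v] awalk_appendI[of u p x q v] by simp
qed

lemma dist_commute:
  assumes "u \<in> pverts G" "v \<in> pverts G"
  shows "dist u v = dist v u"
proof -
  have le: "dist y x \<le> dist x y" if xy: "x \<in> pverts G" "y \<in> pverts G" for x y
  proof -
    obtain p where "awalk x p y" "length p = dist x y"
      using ex_shortest_walk[OF xy] by blast
    then show ?thesis
      using gdist_le_walk[of y "rev_path p" x] by simp
  qed
  show ?thesis using le[OF assms] le[OF assms(2,1)] by simp
qed

lemma dist_arc:
  assumes "(x, y) \<in> parcs G" "u \<in> pverts G"
  shows "dist u y \<le> dist u x + 1"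
proof -
  have "x \<in> pverts G" "y \<in> pverts G"
    using assms wellformed' by auto
  moreover have "dist x y \<le> 1"
    using gdist_le_walk[of x "[(x, y)]" y] assms(1) calculation
    by (simp add: awalk_simps)
  ultimately show ?thesis
    using dist_triangle[of u y x] assms(2) by simp
qed

end

section \<open>Levels of nonseparable sets\<close>

lemma closed_set_reachable:
  assumes "u \<rightarrow>\<^sup>*\<^bsub>H\<^esub> v" "u \<in> S"
    and "\<And>x y. x \<in> S \<Longrightarrow> x \<rightarrow>\<^bsub>H\<^esub> y \<Longrightarrow> y \<in> S"
  shows "v \<in> S"
  using assms(1) unfolding reachable_def
  by (induction rule: rtrancl_on_induct) (use assms(2,3) in auto)

text \<open>
  For finite \<open>B\<close>: the subgraph induced by \<open>B\<close> is connected and remains connected after the removal of any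
  single vertex. The encoding by cuts instead of walks fits the partitions of \<open>B\<close> into distance levels.
  The inequality \<open>\<le> 1\<close> includes the connectedness of \<open>B\<close> itself.
\<close>

definition nonseparable :: "'a rel \<Rightarrow> 'a set \<Rightarrow> bool" where
  "nonseparable E B \<longleftrightarrow>
     (\<forall>S T. S \<subseteq> B \<and> T \<subseteq> B \<and> S \<inter> T = {} \<and> S \<noteq> {} \<and> T \<noteq> {} \<and> card (B - (S \<union> T)) \<le> 1
        \<longrightarrow> (\<exists>x\<in>S. \<exists>y\<in>T. (x, y) \<in> E))"

text \<open>
  Used with \<open>\<phi> = 1\<close> to bound the size of a set from below, and with \<open>\<phi>\<close> the amount by which the
  eccentricity at a level stays below the maximal estimate.
\<close>

lemma sum_levels_ge:
  fixes f :: "'b \<Rightarrow> nat" and \<phi> :: "nat \<Rightarrow> nat"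
  assumes "finite X" and "\<And>i. 1 \<le> i \<Longrightarrow> i < M \<Longrightarrow> 2 \<le> card {x \<in> X. f x = i}"
  shows "2 * (\<Sum>i = 1..<M. \<phi> i) \<le> (\<Sum>x\<in>X. \<phi> (f x))"
proof -
  have "2 * (\<Sum>i = 1..<M. \<phi> i) = (\<Sum>i = 1..<M. 2 * \<phi> i)"
    by (rule sum_distrib_left)
  also have "\<dots> \<le> (\<Sum>i = 1..<M. \<Sum>x \<in> {x \<in> X. f x = i}. \<phi> (f x))"
  proof (rule sum_mono)
    fix i assume "i \<in> {1..<M}"
    then have "2 * \<phi> i \<le> card {x \<in> X. f x = i} * \<phi> i"
      using assms(2) by (intro mult_right_mono) auto
    then show "2 * \<phi> i \<le> (\<Sum>x \<in> {x \<in> X. f x = i}. \<phi> (f x))" by simp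
  qed
  also have "\<dots> = (\<Sum>x \<in> {x \<in> X. f x \<in> {1..<M}}. \<phi> (f x))"
  proof -
    have "(\<Sum>i = 1..<M. \<Sum>x \<in> {x \<in> {x \<in> X. f x \<in> {1..<M}}. f x = i}. \<phi> (f x)) =
      (\<Sum>x \<in> {x \<in> X. f x \<in> {1..<M}}. \<phi> (f x))"
      using assms(1) by (intro sum.group) auto
    moreover have "{x \<in> {x \<in> X. f x \<in> {1..<M}}. f x = i} = {x \<in> X. f x = i}"
      if "i \<in> {1..<M}" for i using that by auto
    ultimately show ?thesis by simp
  qed
  also have "\<dots> \<le> (\<Sum>x\<in>X. \<phi> (f x))"
    using assms(1) by (intro sum_mono2) auto
  finally show ?thesis .
qed

text \<open>
  If an eccentricity is at most \<open>max q (i + l)\<close> at level \<open>i\<close>, it stays below the value \<open>M + l = q + r\<close>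
  estimated for the last level \<open>M\<close> by \<open>min r (M - i)\<close>.
\<close>

lemma double_sum_min:
  fixes r M :: nat
  assumes "r \<le> M" and "1 \<le> r"
  shows "2 * (\<Sum>i = 1..<M. min r (M - i)) = r * (2 * M - r - 1)"
  using assms(1)
proof (induction M rule: dec_induct)
  case base
  have "(\<Sum>i = 1..<r. min r (r - i)) = (\<Sum>i = 1..<r. i)"
    by (rule sum.reindex_bij_witness[of _ "\<lambda>i. r - i" "\<lambda>i. r - i"]) auto
  moreover have "2 * (\<Sum>i = 1..<r. i) = r * (r - 1)"
    using assms(2) by (induction r rule: dec_induct) (auto simp: algebra_simps)
  ultimately show ?case by (simp add: mult_2)
next
  case (step M)
  have "(\<Sum>i = 1..<Suc M. min r (Suc M - i)) = (\<Sum>i = 0..<M. min r (M - i))"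
    by (rule sum.reindex_bij_witness[of _ Suc "\<lambda>i. i - 1"]) auto
  also have "\<dots> = r + (\<Sum>i = 1..<M. min r (M - i))"
    using step assms(2) by (simp add: sum.atLeast_Suc_lessThan)
  finally have *: "2 * (\<Sum>i = 1..<Suc M. min r (Suc M - i)) = 2 * r + r * (2 * M - r - 1)"
    using step.IH by simp
  define t where "t = 2 * M - r - 1"
  have "2 * Suc M - r - 1 = t + 2"
    using step.hyps assms(2) unfolding t_def by simp
  with * show ?case
    unfolding t_def[symmetric] by (simp only: distrib_left mult.commute)
qed

context connected_pair_graph
begin

text \<open>
  Distances from \<open>u\<close> change by at most one along an edge, so no edge joins the levels below \<open>i\<close> to those
  above \<open>i\<close>. If level \<open>i\<close> had at most one vertex, these two parts would contradict
  nonseparability. The distances are those of the whole graph, although the levels are restricted to \<open>B\<close>.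
\<close>

lemma card_level_ge_2:
  assumes "nonseparable (parcs G) B" "B \<subseteq> pverts G" "u \<in> B" "v \<in> B" "0 < i" "i < dist u v"
  shows "2 \<le> card {x \<in> B. dist u x = i}"
proof (rule ccontr)
  assume *: "\<not> ?thesis"
  let ?S = "{x \<in> B. dist u x < i}" and ?T = "{x \<in> B. i < dist u x}"
  have "B - (?S \<union> ?T) = {x \<in> B. dist u x = i}" by auto
  with * have "card (B - (?S \<union> ?T)) \<le> 1" by simp
  moreover have "u \<in> ?S" "v \<in> ?T" using assms by auto
  then have "?S \<noteq> {}" "?T \<noteq> {}" by blast+
  moreover have "?S \<subseteq> B" "?T \<subseteq> B" "?S \<inter> ?T = {}" by auto
  ultimately have "\<exists>x\<in>?S. \<exists>y\<in>?T. (x, y) \<in> parcs G"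
    using assms(1)[unfolded nonseparable_def, rule_format, of ?S ?T] by blast
  then obtain x y where "x \<in> ?S" "y \<in> ?T" "(x, y) \<in> parcs G" by blast
  with dist_arc[of x y u] assms(2,3) show False by auto
qed

text \<open>
  The levels \<open>1, \<dots>, d(u,v) - 1\<close> contribute two vertices each, and \<open>u\<close> and \<open>v\<close> themselves two more.
\<close>

lemma dist_nonseparable:
  assumes "nonseparable (parcs G) B" "B \<subseteq> pverts G" "u \<in> B" "v \<in> B"
  shows "2 * dist u v \<le> card B"
proof (cases "u = v")
  case True
  then show ?thesis using assms by auto
next
  case False
  let ?d = "dist u v"
  let ?C = "{x \<in> B. 1 \<le> dist u x \<and> dist u x < ?d}"
  have fin: "finite B" using assms(2) finite_subset finite_verts by blast
  have "2 * (\<Sum>i = 1..<?d. 1) \<le> (\<Sum>x\<in>?C. 1::nat)"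
  proof (rule sum_levels_ge[where f = "dist u" and \<phi> = "\<lambda>_. 1"])
    fix i :: nat assume i: "1 \<le> i" "i < ?d"
    then have "{x \<in> ?C. dist u x = i} = {x \<in> B. dist u x = i}" by auto
    then show "2 \<le> card {x \<in> ?C. dist u x = i}"
      using card_level_ge_2[OF assms] i by simp
  qed (use fin in simp)
  then have "2 * (?d - 1) + 2 \<le> card (insert u (insert v ?C))"
    using False fin assms by (auto simp: card_insert_if)
  also have "\<dots> \<le> card B"
    using assms fin by (intro card_mono) auto
  finally show ?thesis by simp
qed

section \<open>Components around a unique cut vertex\<close>

definition component_avoiding :: "'a \<Rightarrow> 'a \<Rightarrow> 'a set" where
  "component_avoiding w a = {y. a \<rightarrow>\<^sup>*\<^bsub>del_vert w\<^esub> y}"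

lemma arc_del_vert: "x \<rightarrow>\<^bsub>del_vert w\<^esub> y \<longleftrightarrow> (x, y) \<in> parcs G \<and> x \<noteq> w \<and> y \<noteq> w"
  by (auto simp: arcs_ends_def arc_to_ends_def del_vert_simps image_iff)

lemma sym_digraph_del_vert: "sym_digraph (del_vert w)"
proof -
  interpret H: wf_digraph "del_vert w" by (rule wf_digraph_del_vert)
  show ?thesis
    by unfold_locales (auto simp: symmetric_def sym_def arc_del_vert intro: arcs_symmetric)
qed

lemma component_avoiding_subset: "component_avoiding w a \<subseteq> pverts G - {w}"
proof -
  interpret H: wf_digraph "del_vert w" by (rule wf_digraph_del_vert)
  show ?thesis
    unfolding component_avoiding_def using H.reachable_in_verts by (auto simp: del_vert_simps)
qed

lemma component_avoiding_self:
  assumes "a \<in> pverts G" "a \<noteq> w"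
  shows "a \<in> component_avoiding w a"
proof -
  interpret H: wf_digraph "del_vert w" by (rule wf_digraph_del_vert)
  show ?thesis
    unfolding component_avoiding_def using assms by (auto simp: del_vert_simps)
qed

lemma component_avoiding_arc:
  assumes "x \<in> component_avoiding w a" "(x, y) \<in> parcs G" "y \<noteq> w"
  shows "y \<in> component_avoiding w a"
proof -
  interpret H: wf_digraph "del_vert w" by (rule wf_digraph_del_vert)
  have "x \<rightarrow>\<^bsub>del_vert w\<^esub> y"
    using assms component_avoiding_subset arc_del_vert by blast
  with assms(1) show ?thesis
    unfolding component_avoiding_def by (auto intro: H.reachable_adj_trans)
qed

lemma component_avoiding_reachable:
  assumes "x \<in> component_avoiding w a" "y \<in> component_avoiding w a"
  shows "x \<rightarrow>\<^sup>*\<^bsub>del_vert w\<^esub> y"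
proof -
  interpret H: sym_digraph "del_vert w" by (rule sym_digraph_del_vert)
  show ?thesis
    using assms unfolding component_avoiding_def
    by (auto intro: H.symmetric_reachable' H.reachable_trans)
qed

lemma component_avoiding_disjoint:
  assumes "z \<notin> component_avoiding w a"
  shows "component_avoiding w z \<inter> component_avoiding w a = {}"
proof -
  interpret H: sym_digraph "del_vert w" by (rule sym_digraph_del_vert)
  show ?thesis
    using assms unfolding component_avoiding_def
    by (auto dest: H.symmetric_reachable' H.reachable_trans)
qed

lemma del_vert_reachable:
  assumes "connected (del_vert x)" "u \<in> pverts G - {x}" "v \<in> pverts G - {x}"
  shows "u \<rightarrow>\<^sup>*\<^bsub>del_vert x\<^esub> v"
proof -
  interpret H: sym_digraph "del_vert x" by (rule sym_digraph_del_vert)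
  show ?thesis
    using H.symmetric_connected_imp_strongly_connected[OF H.sym_arcs assms(1)] assms(2,3)
    by (auto simp: strongly_connected_def del_vert_simps)
qed

text \<open>
  Consider two parts of the set whose remainder \<open>R\<close> has at most one vertex, and suppose that no edge joins
  them. The component has no edges to vertices outside it other than \<open>w\<close>, so a part \<open>S\<close>
  without \<open>w\<close> can only be left through \<open>R\<close>. If \<open>R = {w}\<close> this contradicts the connectedness of the component;
  if \<open>R\<close> is empty or \<open>{x}\<close> for some other vertex \<open>x\<close>, it contradicts that \<open>S\<close> is joined to \<open>w\<close> in \<open>G\<close>
  or in \<open>G - x\<close>, respectively.
\<close>

lemma nonseparable_component:
  assumes w: "w \<in> pverts G"
    and others: "\<And>x. x \<in> pverts G \<Longrightarrow> x \<noteq> w \<Longrightarrow> connected (del_vert x)"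
  shows "nonseparable (parcs G) (insert w (component_avoiding w a))"
proof -
  let ?A = "component_avoiding w a"
  \<comment> \<open>At most one of the two parts contains \<open>w\<close>; edges being symmetric, it may be taken to be \<open>T\<close>.\<close>
  have arc: "\<exists>x\<in>S. \<exists>y\<in>T. (x, y) \<in> parcs G"
    if ST: "S \<subseteq> ?A" "T \<subseteq> insert w ?A" "S \<inter> T = {}" "S \<noteq> {}" "T \<noteq> {}"
      "card (insert w ?A - (S \<union> T)) \<le> 1" for S T
  proof (rule ccontr)
    assume no_arc: "\<not> ?thesis"
    define R where "R = insert w ?A - (S \<union> T)"
    have A: "?A \<subseteq> pverts G - {w}" by (rule component_avoiding_subset)
    then have "finite R"
      unfolding R_def using finite_subset[OF _ finite_verts] by blast
    with ST(6) have R_unique: "x = y" if "x \<in> R" "y \<in> R" for x y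
      using that card_le_Suc0_iff_eq[of R] unfolding R_def by simp
    have step: "y \<in> S" if "x \<in> S" "(x, y) \<in> parcs G" "y \<notin> R" for x y
    proof -
      have "y \<in> insert w ?A"
        using component_avoiding_arc[OF _ that(2)] that(1) ST(1) by blast
      then show ?thesis using that no_arc unfolding R_def by blast
    qed
    obtain s t where s: "s \<in> S" and t: "t \<in> T" using ST by blast
    show False
    proof (cases "w \<in> T")
      case False
      with ST(1) A have w_R: "w \<in> R" unfolding R_def by blast
      have "s \<in> ?A" "t \<in> ?A"
        using s t ST(1,2) False by blast+
      then have "s \<rightarrow>\<^sup>*\<^bsub>del_vert w\<^esub> t" by (rule component_avoiding_reachable)
      then have "t \<in> S"
        using s
      proof (rule closed_set_reachable)
        fix x y assume "x \<in> S" "x \<rightarrow>\<^bsub>del_vert w\<^esub> y"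
        then show "y \<in> S" using step R_unique[OF _ w_R] unfolding arc_del_vert by blast
      qed
      with t ST show False by blast
    next
      case True
      have s': "s \<in> pverts G" "s \<noteq> w" using s ST(1) A by blast+
      have "w \<in> S"
      proof (cases "R = {}")
        case True
        have "s \<rightarrow>\<^sup>*\<^bsub>with_proj G\<^esub> w" by (rule reachable_verts[OF s'(1) w])
        then show ?thesis
          using s
        proof (rule closed_set_reachable)
          fix x y assume "x \<in> S" "x \<rightarrow>\<^bsub>with_proj G\<^esub> y"
          then show "y \<in> S" using step True by simp
        qed
      next
        case False
        then obtain x where x_R: "x \<in> R" by blast
        then have x: "x \<in> pverts G" "x \<noteq> w" "x \<noteq> s"
          using A True s unfolding R_def by blast+
        have "s \<rightarrow>\<^sup>*\<^bsub>del_vert x\<^esub> w"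
          using x s' w by (intro del_vert_reachable others) auto
        then show ?thesis
          using s
        proof (rule closed_set_reachable)
          fix x' y assume "x' \<in> S" "x' \<rightarrow>\<^bsub>del_vert x\<^esub> y"
          then show "y \<in> S" using step R_unique[OF _ x_R] unfolding arc_del_vert by blast
        qed
      qed
      with True ST show False by blast
    qed
  qed
  show ?thesis
    unfolding nonseparable_def
  proof (intro allI impI, elim conjE)
    fix S T
    assume *: "S \<subseteq> insert w ?A" "T \<subseteq> insert w ?A" "S \<inter> T = {}" "S \<noteq> {}" "T \<noteq> {}"
      "card (insert w ?A - (S \<union> T)) \<le> 1"
    show "\<exists>x\<in>S. \<exists>y\<in>T. (x, y) \<in> parcs G"
    proof (cases "w \<in> S")
      case False
      with * show ?thesis by (intro arc) auto
    next
      case True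
      with * have "\<exists>y\<in>T. \<exists>x\<in>S. (y, x) \<in> parcs G"
        by (intro arc) (auto simp: Un_commute)
      then show ?thesis using arcs_symmetric by blast
    qed
  qed
qed

lemma eccentricity_le:
  assumes "v \<in> pverts G" and "\<And>u. u \<in> pverts G \<Longrightarrow> dist v u \<le> c"
  shows "eccentricity G v \<le> c"
  unfolding eccentricity_def using assms finite_verts by (subst Max_le_iff) auto

end

section \<open>The extremal value\<close>

text \<open>
  The hypothesis on \<open>T\<close> is the sum of the eccentricity estimates in a graph whose two sides of the cut vertex have
  sizes \<open>a\<close>, \<open>b\<close> and heights \<open>h\<close>, \<open>l\<close>. With \<open>s = q - h\<close> it reads
  \<open>T \<le> n (h + l) - (2 h - 1) (l - s) - s (2 l - s)\<close>. The sizes force \<open>k \<ge> h + l + s - 1\<close>. If \<open>k \<ge> h + l\<close>, it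
  suffices that the subtracted terms are nonnegative. Otherwise \<open>s = 0\<close> and \<open>k = h + l - 1\<close>,
  so that \<open>n\<close> is \<open>2 k + 1\<close> or \<open>2 k + 2\<close>, and the claim becomes \<open>(2 h - 3) (l - 1) \<ge> 0\<close>.
\<close>

lemma total_bound_of_heights:
  fixes a b h l q n k T :: nat
  assumes n: "n = a + b + 1" and q: "q = (a + 1) div 2" and k: "k = (n - 1) div 2"
    and "1 \<le> l" "l \<le> h" "h \<le> q" "q < h + l" and b: "2 * l \<le> b + 1"
    and T: "T + l * (l - 1) + (h + l - q) * (2 * h - (h + l - q) - 1) \<le> h + (a + b) * (h + l)"
  shows "T \<le> n * k + (if even n then 3 else 2)"
proof -
  define s where "s = q - h"
  have s: "q = h + s" "s < l" using \<open>h \<le> q\<close> \<open>q < h + l\<close> by (auto simp: s_def)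
  define H L S N K where "H = int h" and "L = int l" and "S = int s" and "N = int n" and "K = int k"
  note defs = H_def L_def S_def N_def K_def
  have ranges: "0 \<le> S" "S + 1 \<le> L" "L \<le> H" using s assms by (auto simp: defs)
  have r: "int (h + l - q) = L - S" using s by (simp add: defs)
  have sub: "int (2 * h - (h + l - q) - 1) = 2 * H - (L - S) - 1" "int (l - 1) = L - 1"
    using s assms(4,5) by (auto simp: defs)
  have "int T + L * (L - 1) + (L - S) * (2 * H - (L - S) - 1) \<le> H + (N - 1) * (H + L)"
  proof -
    have "int (T + l * (l - 1) + (h + l - q) * (2 * h - (h + l - q) - 1))
        \<le> int (h + (a + b) * (h + l))"
      using T by (simp only: of_nat_le_iff)
    then show ?thesis
      unfolding of_nat_add[of _ "_ * _"] of_nat_add[of T] of_nat_mult r sub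
      using n by (simp add: defs)
  qed
  then have T': "int T + (2 * H - 1) * (L - S) + S * (2 * L - S) \<le> N * (H + L)"
    by (simp add: algebra_simps)
  have "n \<ge> 2 * q + 2 * l - 1" using n q b by linarith
  then have k_ge: "k + 1 \<ge> h + s + l" using k s(1) by linarith
  have "int T \<le> N * K + (if even n then 3 else 2)"
  proof (cases "h + l \<le> k")
    case True
    then have "N * (H + L) \<le> N * K"
      by (intro mult_left_mono) (auto simp: defs)
    moreover have "0 \<le> (2 * H - 1) * (L - S)" "0 \<le> S * (2 * L - S)"
      using ranges by auto
    ultimately show ?thesis using T' by simp
  next
    case False
    with k_ge have S: "S = 0" and K: "K = H + L - 1" by (auto simp: defs)
    have N: "N = 2 * K + (if even n then 2 else 1)"
      using k n by (auto simp: defs elim!: evenE oddE)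
    have "0 \<le> (2 * H - 3) * (L - 1)"
    proof (cases "L = 1")
      case False
      with ranges S show ?thesis by (intro mult_nonneg_nonneg) auto
    qed simp
    moreover have "N * (H + L) = N * K + N" by (simp add: K algebra_simps)
    moreover have "int T + (2 * H - 1) * L \<le> N * (H + L)" using T' S by simp
    ultimately have "int T + (2 * H - 1) * L \<le> N * K + N" "0 \<le> (2 * H - 3) * (L - 1)"
      by simp_all
    moreover have "(2 * H - 1) * L = 2 * (H * L) - L"
      "(2 * H - 3) * (L - 1) = 2 * (H * L) - 2 * H - 3 * L + 3"
      by (simp_all add: algebra_simps)
    ultimately show ?thesis
      using N K by (simp split: if_splits)
  qed
  also have "N * K + (if even n then 3 else 2) = int (n * k + (if even n then 3 else 2))"
    by (simp add: defs)
  finally show ?thesis by (simp only: of_nat_le_iff)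
qed

lemma unicyclic_cycle_arcs:
  shows "pverts (unicyclic_l (Suc m) m) = {..<Suc m}"
    and "parcs (unicyclic_l (Suc m) m) =
      (let E = insert (0, m) ((\<lambda>i. (i, Suc i mod m)) ` {..<m}) in E \<union> E\<inverse>)"
  by (auto simp: unicyclic_l_def Let_def)

text \<open>
  The distance of \<open>x\<close> from the cycle vertex \<open>c\<close>, where \<open>m\<close> is the pendant vertex, attached at \<open>0\<close>. Its
  Lipschitz property turns its values into lower bounds for distances, hence for eccentricities.
\<close>

definition lollipop_potential :: "nat \<Rightarrow> nat \<Rightarrow> nat \<Rightarrow> int" where
  "lollipop_potential m c x =
     (if x = m then min (int c) (int m - int c) + 1
      else min \<bar>int c - int x\<bar> (int m - \<bar>int c - int x\<bar>))"

lemma lollipop_potential_arc: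
  assumes "m \<ge> 3" "c < m" and xy: "(x, y) \<in> parcs (unicyclic_l (Suc m) m)"
  shows "lollipop_potential m c y \<le> lollipop_potential m c x + 1"
proof -
  have step: "\<bar>lollipop_potential m c (Suc i mod m) - lollipop_potential m c i\<bar> \<le> 1" if "i < m" for i
  proof (cases "Suc i = m")
    case True
    with assms that show ?thesis by (auto simp: lollipop_potential_def)
  next
    case False
    with assms that show ?thesis
      by (auto simp: lollipop_potential_def min_def abs_if)
  qed
  have pendant: "lollipop_potential m c m = lollipop_potential m c 0 + 1"
    using assms by (simp add: lollipop_potential_def)
  consider i where "i < m" "x = i" "y = Suc i mod m" | i where "i < m" "y = i" "x = Suc i mod m"
    | "x = 0" "y = m" | "x = m" "y = 0"
    using xy unfolding unicyclic_cycle_arcs Let_def by blast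
  then show ?thesis
    using pendant step by cases (fastforce dest: step)+
qed

lemma unicyclic_reachable:
  assumes "m \<ge> 3" "u < Suc m" "v < Suc m"
  shows "u \<rightarrow>\<^sup>*\<^bsub>with_proj (unicyclic_l (Suc m) m)\<^esub> v"
proof -
  let ?U = "unicyclic_l (Suc m) m"
  interpret U: pair_graph ?U by (rule pair_graph_unicyclic_l) (use assms in auto)
  have cycle: "0 \<rightarrow>\<^sup>*\<^bsub>with_proj ?U\<^esub> x" if "x < m" for x
    using that
  proof (induction x)
    case 0
    have "0 \<in> pverts ?U" by (simp add: unicyclic_cycle_arcs)
    then show ?case by (rule U.reachable_refl)
  next
    case (Suc x)
    then have "(x, Suc x) \<in> parcs ?U"
      by (auto simp: unicyclic_cycle_arcs Let_def image_iff intro!: bexI[of _ x])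
    with Suc show ?case by (auto intro: U.reachable_adj_trans)
  qed
  have "(0, m) \<in> parcs ?U" using assms by (auto simp: unicyclic_cycle_arcs Let_def)
  then have "0 \<rightarrow>\<^sup>*\<^bsub>with_proj ?U\<^esub> m" by auto
  with cycle have "0 \<rightarrow>\<^sup>*\<^bsub>with_proj ?U\<^esub> x" if "x < Suc m" for x
    using that by (cases "x = m") auto
  with assms show ?thesis by (meson U.symmetric_reachable' U.reachable_trans)
qed

text \<open>
  A cycle vertex \<open>v\<close> is at distance \<open>\<lfloor>m / 2\<rfloor>\<close> from one of \<open>v \<plusminus> \<lfloor>m / 2\<rfloor>\<close>. The vertices
  \<open>\<lfloor>m / 2\<rfloor>\<close> and \<open>m - \<lfloor>m / 2\<rfloor>\<close> opposite to \<open>0\<close> are one farther from the pendant vertex; they coincide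
  when \<open>m\<close> is even.
\<close>

lemma total_eccentricity_unicyclic_ge:
  assumes "m \<ge> 3"
  shows "(m + 1) * (m div 2) + (if even m then 2 else 3)
    \<le> total_eccentricity (unicyclic_l (Suc m) m)"
proof -
  let ?U = "unicyclic_l (Suc m) m" and ?k = "m div 2"
  let ?far = "{?k, m - ?k, m}"
  interpret U: pair_graph ?U by (rule pair_graph_unicyclic_l) (use assms in auto)
  have verts: "pverts ?U = {..<Suc m}" using assms by (simp add: unicyclic_cycle_arcs)
  have ecc: "\<bar>lollipop_potential m c u - lollipop_potential m c v\<bar> \<le> int (eccentricity ?U v)"
    if "c < m" "u < Suc m" "v < Suc m" for c u v
  proof -
    have reach: "v \<rightarrow>\<^sup>*\<^bsub>with_proj ?U\<^esub> u" using that assms by (intro unicyclic_reachable)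
    have arc: "lollipop_potential m c y \<le> lollipop_potential m c x + 1"
      if "(x, y) \<in> parcs ?U" for x y
      using lollipop_potential_arc assms \<open>c < m\<close> that .
    have "lollipop_potential m c u - lollipop_potential m c v \<le> int (gdist ?U v u)"
      using arc reach by (rule U.lipschitz_le_gdist)
    \<comment> \<open>The opposite sign is needed for \<open>v = m\<close>, as \<open>c\<close> ranges over cycle vertices only.\<close>
    moreover have "- lollipop_potential m c u - - lollipop_potential m c v \<le> int (gdist ?U v u)"
      using reach by (rule U.lipschitz_le_gdist[rotated]) (use arc U.arcs_symmetric in fastforce)
    ultimately have "\<bar>lollipop_potential m c u - lollipop_potential m c v\<bar> \<le> int (gdist ?U v u)"
      by linarith
    also have "gdist ?U v u \<le> eccentricity ?U v"
      unfolding eccentricity_def using that by (intro Max_ge) (auto simp: verts)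
    finally show ?thesis by simp
  qed
  have near: "?k \<le> eccentricity ?U v" if "v < m" for v
  proof (cases "v < ?k")
    case True
    then have "v + ?k < m" and diff: "\<bar>int v - int (v + ?k)\<bar> = int ?k" by auto
    with ecc[of v "v + ?k" v] that show ?thesis
      unfolding lollipop_potential_def diff by auto
  next
    case False
    then have diff: "\<bar>int v - int (v - ?k)\<bar> = int ?k" by auto
    moreover have "v - ?k \<noteq> m" using that by simp
    ultimately show ?thesis
      using ecc[of v "v - ?k" v] that unfolding lollipop_potential_def diff by auto
  qed
  have far: "?k + 1 \<le> eccentricity ?U v" if "v \<in> {?k, m - ?k}" for v
    using ecc[of v m v] that assms by (auto simp: lollipop_potential_def)
  have "?k + 1 \<le> eccentricity ?U m"
  proof -
    have "?k < m" using assms by simp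
    then have "lollipop_potential m ?k m = int ?k + 1" "lollipop_potential m ?k ?k = 0"
      by (auto simp: lollipop_potential_def)
    with ecc[of ?k ?k m] \<open>?k < m\<close> show ?thesis by simp
  qed
  with near far have ecc_ge: "?k + of_bool (v \<in> ?far) \<le> eccentricity ?U v" if "v < Suc m" for v
    using that by (cases "v = m") auto
  have "card ?far = (if even m then 2 else 3)"
  proof -
    have "?k = m - ?k \<longleftrightarrow> even m" by presburger
    moreover have "?k < m" "m - ?k < m" using assms by auto
    ultimately show ?thesis by (auto simp: card_insert_if)
  qed
  moreover have "{..<Suc m} \<inter> ?far = ?far" by auto
  ultimately have "(\<Sum>v<Suc m. of_bool (v \<in> ?far)) = (if even m then 2 else 3 :: nat)"
    by (subst sum_of_bool_eq) (simp_all only: Collect_mem_eq finite_lessThan of_nat_id)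
  then have "(m + 1) * ?k + (if even m then 2 else 3) = (\<Sum>v<Suc m. ?k + of_bool (v \<in> ?far))"
    by (simp only: sum.distrib sum_constant card_lessThan of_nat_id Suc_eq_plus1)
  also have "\<dots> \<le> total_eccentricity ?U"
    unfolding total_eccentricity_def verts using ecc_ge by (intro sum_mono) auto
  finally show ?thesis .
qed

section \<open>The upper bound\<close>

context connected_pair_graph
begin

lemma ex_farthest:
  assumes "X \<noteq> {}" "X \<subseteq> pverts G"
  obtains x where "x \<in> X" "\<And>y. y \<in> X \<Longrightarrow> dist w y \<le> dist w x"
proof -
  have "finite X" using assms finite_subset finite_verts by blast
  then have "Max (dist w ` X) \<in> dist w ` X" and "\<forall>y\<in>X. dist w y \<le> Max (dist w ` X)"
    using assms by auto
  then show thesis using that by fastforce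
qed

lemma total_eccentricity_unique_cut_vertex:
  assumes w: "w \<in> pverts G" and cut: "\<not> connected (del_vert w)" "pverts G \<noteq> {w}"
    and others: "\<And>x. x \<in> pverts G \<Longrightarrow> x \<noteq> w \<Longrightarrow> connected (del_vert x)"
    and n: "card (pverts G) = n"
  shows "total_eccentricity G \<le> n * ((n - 1) div 2) + (if even n then 3 else 2)"
proof -
  let ?V = "pverts G" and ?e = "eccentricity G" and ?k = "(n - 1) div 2"
  obtain y where y: "y \<in> ?V - {w}" "\<And>u. u \<in> ?V - {w} \<Longrightarrow> dist w u \<le> dist w y"
    using ex_farthest[of "?V - {w}" w] cut(2) w by blast
  define h where "h = dist w y"
  define A where "A = component_avoiding w y"
  define B where "B = ?V - {w} - A"
  have A_V: "A \<subseteq> ?V - {w}" unfolding A_def by (rule component_avoiding_subset)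
  have y_A: "y \<in> A" unfolding A_def using y by (intro component_avoiding_self) auto
  have V: "?V = insert w (A \<union> B)" using A_V w by (auto simp: B_def)
  have w_AB: "w \<notin> A \<union> B" and AB: "A \<inter> B = {}" using A_V by (auto simp: B_def)
  have fin: "finite A" "finite B" using V finite_verts by (metis finite_Un finite_insert)+
  have dist_h: "dist w u \<le> h" if "u \<in> ?V" for u
    using y(2)[of u] that w by (cases "u = w") (auto simp: h_def)
  \<comment> \<open>The vertex \<open>w\<close> is a cut vertex, so its removal leaves more than one component.\<close>
  have "B \<noteq> {}"
  proof
    assume "B = {}"
    then have "?V - {w} = A" using V w_AB by blast
    interpret H: wf_digraph "del_vert w" by (rule wf_digraph_del_vert)
    have "connected (del_vert w)"
      unfolding connected_def
    proof (rule strongly_connectedI)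
      show "verts (mk_symmetric (del_vert w)) \<noteq> {}"
        using y(1) by (auto simp: del_vert_simps)
      fix u v
      assume "u \<in> verts (mk_symmetric (del_vert w))" "v \<in> verts (mk_symmetric (del_vert w))"
      then have "u \<in> A" "v \<in> A"
        using \<open>?V - {w} = A\<close> by (simp_all add: del_vert_simps)
      then show "u \<rightarrow>\<^sup>*\<^bsub>mk_symmetric (del_vert w)\<^esub> v"
        unfolding A_def by (intro H.reachable_mk_symmetricI component_avoiding_reachable)
    qed
    with cut(1) show False ..
  qed
  then obtain z where z: "z \<in> B" "\<And>u. u \<in> B \<Longrightarrow> dist w u \<le> dist w z"
    using ex_farthest[of B w] V by blast
  define l where "l = dist w z"
  \<comment> \<open>The set \<open>B\<close> may consist of several components. The component \<open>Z\<close> of its farthest vertex already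
    provides two vertices of \<open>B\<close> on each inner level.\<close>
  define Z where "Z = component_avoiding w z"
  have z_V: "z \<in> ?V" "z \<noteq> w" using z(1) V w_AB by blast+
  have z_Z: "z \<in> Z" unfolding Z_def using z_V by (rule component_avoiding_self)
  have "Z \<inter> A = {}"
    using component_avoiding_disjoint z(1) unfolding Z_def A_def B_def by blast
  then have Z_B: "Z \<subseteq> B"
    using component_avoiding_subset[of w z] unfolding Z_def B_def by blast
  have l: "1 \<le> l" "l \<le> h"
    using dist_eq_0_iff[OF w z_V(1)] z_V dist_h by (auto simp: l_def)
  define a b where "a = card A" and "b = card B"
  have n_ab: "n = a + b + 1"
    using n w_AB AB fin by (simp add: V card_Un_disjoint a_def b_def)
  define q where "q = (a + 1) div 2"
  have block_A: "nonseparable (parcs G) (insert w A)" and block_Z: "nonseparable (parcs G) (insert w Z)"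
    unfolding A_def Z_def by (rule nonseparable_component[OF w others]; assumption)+
  have sub: "insert w A \<subseteq> ?V" "insert w Z \<subseteq> ?V" using V Z_B by blast+
  have dist_A: "dist u v \<le> q" if "u \<in> insert w A" "v \<in> insert w A" for u v
    using dist_nonseparable[OF block_A sub(1) that] w_AB fin by (simp add: q_def a_def)
  have "h \<le> q" unfolding h_def using y_A by (intro dist_A) auto
  have "2 * l \<le> card (insert w Z)"
    unfolding l_def using z_Z by (intro dist_nonseparable[OF block_Z sub(2)]) auto
  also have "\<dots> \<le> b + 1"
  proof -
    have "card (insert w Z) \<le> card (insert w B)"
      using Z_B fin by (intro card_mono) auto
    then show ?thesis using w_AB fin by (simp add: b_def)
  qed
  finally have b: "2 * l \<le> b + 1" .
  have level: "{x \<in> C. dist w x = i} = {x \<in> insert w C. dist w x = i}" if "1 \<le> i" for C i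
    using that w by auto
  have level_A: "2 \<le> card {x \<in> A. dist w x = i}" if "1 \<le> i" "i < h" for i
  proof -
    have "2 \<le> card {x \<in> insert w A. dist w x = i}"
      using that y_A by (intro card_level_ge_2[OF block_A sub(1), of w y]) (auto simp: h_def)
    then show ?thesis by (simp only: level[OF that(1), symmetric])
  qed
  have level_B: "2 \<le> card {x \<in> B. dist w x = i}" if "1 \<le> i" "i < l" for i
  proof -
    have "2 \<le> card {x \<in> insert w Z. dist w x = i}"
      using that z_Z by (intro card_level_ge_2[OF block_Z sub(2), of w z]) (auto simp: l_def)
    then have "2 \<le> card {x \<in> Z. dist w x = i}" by (simp only: level[OF that(1), symmetric])
    also have "\<dots> \<le> card {x \<in> B. dist w x = i}"
      using fin Z_B by (intro card_mono) auto
    finally show ?thesis .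
  qed
  have via_w: "dist v u \<le> dist w v + dist w u" if "u \<in> ?V" "v \<in> ?V" for u v
    using dist_triangle[of v u w] dist_commute[of v w] that w by simp
  have ecc_w: "?e w \<le> h" using w dist_h by (rule eccentricity_le)
  have ecc_any: "?e v \<le> dist w v + h" if "v \<in> ?V" for v
    using that(1)
  proof (rule eccentricity_le)
    fix u assume "u \<in> ?V"
    then show "dist v u \<le> dist w v + h"
      using via_w[of u v] dist_h[of u] that by simp
  qed
  have ecc_A: "?e v \<le> max q (dist w v + l)" if "v \<in> A" for v
  proof (rule eccentricity_le)
    show v: "v \<in> ?V" using that V by blast
    fix u assume u: "u \<in> ?V"
    show "dist v u \<le> max q (dist w v + l)"
    proof (cases "u \<in> B")
      case True
      then show ?thesis using via_w[OF u v] z(2)[of u] by (simp add: l_def)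
    next
      case False
      with u V have "u \<in> insert w A" by blast
      with that show ?thesis using dist_A[of v u] by simp
    qed
  qed
  have total: "total_eccentricity G = ?e w + (\<Sum>v\<in>A. ?e v) + (\<Sum>v\<in>B. ?e v)"
    unfolding total_eccentricity_def V using w_AB AB fin by (simp add: sum.union_disjoint)
  \<comment> \<open>A vertex of \<open>B\<close> at distance \<open>d\<close> from \<open>w\<close> falls short of \<open>h + l\<close> by at least \<open>l - d\<close>.\<close>
  have sum_B: "(\<Sum>v\<in>B. ?e v) + l * (l - 1) \<le> b * (h + l)"
  proof -
    have "l * (l - 1) = 2 * (\<Sum>i = 1..<l. min l (l - i))"
      using double_sum_min[of l l] l by (simp add: mult_2)
    also have "\<dots> \<le> (\<Sum>v\<in>B. min l (l - dist w v))"
      using fin(2) level_B by (rule sum_levels_ge)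
    finally have "(\<Sum>v\<in>B. ?e v) + l * (l - 1) \<le> (\<Sum>v\<in>B. ?e v + min l (l - dist w v))"
      by (simp add: sum.distrib)
    also have "\<dots> \<le> (\<Sum>v\<in>B. h + l)"
    proof (rule sum_mono)
      fix v assume "v \<in> B"
      then show "?e v + min l (l - dist w v) \<le> h + l"
        using ecc_any[of v] z(2)[of v] V by (simp add: l_def)
    qed
    finally show ?thesis by (simp add: b_def)
  qed
  show ?thesis
  proof (cases "q < h + l")
    case True
    \<comment> \<open>A vertex of \<open>A\<close> at distance \<open>d\<close> falls short by \<open>h + l - max q (d + l) = min r (h - d)\<close>.\<close>
    define r where "r = h + l - q"
    have r: "1 \<le> r" "r \<le> h" "q + r = h + l"
      using True l \<open>h \<le> q\<close> by (auto simp: r_def)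
    have "r * (2 * h - r - 1) = 2 * (\<Sum>i = 1..<h. min r (h - i))"
      using double_sum_min[of r h] r by simp
    also have "\<dots> \<le> (\<Sum>v\<in>A. min r (h - dist w v))"
      using fin(1) level_A by (rule sum_levels_ge)
    finally have "(\<Sum>v\<in>A. ?e v) + r * (2 * h - r - 1) \<le> (\<Sum>v\<in>A. ?e v + min r (h - dist w v))"
      by (simp add: sum.distrib)
    also have "\<dots> \<le> (\<Sum>v\<in>A. h + l)"
    proof (rule sum_mono)
      fix v assume "v \<in> A"
      then show "?e v + min r (h - dist w v) \<le> h + l"
        using ecc_A[of v] dist_h[of v] V r(3) by (auto simp: min_def max_def split: if_splits)
    qed
    finally have sum_A: "(\<Sum>v\<in>A. ?e v) + r * (2 * h - r - 1) \<le> a * (h + l)"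
      by (simp add: a_def)
    have "total_eccentricity G + l * (l - 1) + r * (2 * h - r - 1) \<le> h + (a + b) * (h + l)"
      unfolding total add_mult_distrib using ecc_w sum_A sum_B by linarith
    then show ?thesis
      unfolding r_def
      using n_ab q_def l \<open>h \<le> q\<close> True b
      by (intro total_bound_of_heights[where h = h and l = l and a = a and b = b and q = q]) auto
  next
    case False
    \<comment> \<open>Here \<open>q\<close> dominates every estimate, and \<open>q \<le> k\<close>.\<close>
    have "(\<Sum>v\<in>A. ?e v) \<le> (\<Sum>v\<in>A. q)"
    proof (rule sum_mono)
      fix v assume "v \<in> A"
      then show "?e v \<le> q"
        using ecc_A[of v] dist_h[of v] V False by auto
    qed
    moreover have "b * (h + l) \<le> b * q" using False by (intro mult_left_mono) auto
    ultimately have "total_eccentricity G \<le> q + a * q + b * q"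
      using total ecc_w sum_B \<open>h \<le> q\<close> unfolding a_def sum_constant of_nat_id by linarith
    also have "\<dots> = n * q" by (simp add: n_ab algebra_simps)
    also have "\<dots> \<le> n * ?k"
      using b l n_ab by (intro mult_left_mono) (auto simp: q_def)
    finally show ?thesis by simp
  qed
qed

end

theorem theorem4p9:
  fixes n :: nat and G :: "'a pair_pre_digraph"
  assumes "5 \<le> n"
    and "G \<in> graphs_with_cut_vertices n 1"
  shows "total_eccentricity G \<le> total_eccentricity (unicyclic_l n (n - 1))"
proof -
  have G: "pair_graph G" "connected (with_proj G)" "card (pverts G) = n"
    and "card {w. cut_vertex G w} = 1"
    using assms(2) by (auto simp: graphs_with_cut_vertices_def)
  then obtain w where w: "{w. cut_vertex G w} = {w}"
    using card_1_singletonE by blast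
  interpret connected_pair_graph G
    by (intro connected_pair_graph.intro connected_pair_graph_axioms.intro G(1,2))
  have cut_iff: "cut_vertex G x \<longleftrightarrow> x = w" for x
    using w by (auto simp: set_eq_iff)
  have cut: "w \<in> pverts G" "pverts G \<noteq> {w}" "\<not> connected (del_vert w)"
    using cut_iff[of w] by (simp_all add: cut_vertex_def)
  have "connected (del_vert x)" if "x \<in> pverts G" "x \<noteq> w" for x
  proof -
    have "pverts G \<noteq> {x}" using that cut(1) by auto
    with cut_iff[of x] that show ?thesis by (simp add: cut_vertex_def)
  qed
  then have "total_eccentricity G \<le> n * ((n - 1) div 2) + (if even n then 3 else 2)"
    using G(3) by (intro total_eccentricity_unique_cut_vertex[OF cut(1,3,2)])
  also have "\<dots> \<le> total_eccentricity (unicyclic_l n (n - 1))"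
  proof -
    obtain m where m: "n = Suc m" "3 \<le> m"
      using assms(1) by (cases n) auto
    show ?thesis
      using total_eccentricity_unicyclic_ge[OF m(2)] by (cases "even m") (simp_all add: m(1))
  qed
  finally show ?thesis .
qed

end
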